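(* For every positive integer $n$ with $n \equiv 13 \pmod{24}$ there exist positive integers $x, y, z$ such that $$\frac{4}{n} = \frac{1}{x} + \frac{1}{y} + \frac{1}{z}.$$
   Context: The equation is an equality of rational numbers; $x, y, z$ are not required to be distinct. *)

theory Defs
  imports Complex_Main "HOL-Number_Theory.Cong"
begin

end

theory Submission
  imports Defs
begin

theorem theorem3p1:
  fixes n :: nat
  assumes "n > 0" and "[n = 13] (mod 24)"
  shows "\<exists>x y z :: nat. x > 0 \<and> y > 0 \<and> z > 0 \<and>
    (4 :: rat) / of_nat n = 1 / of_nat x + 1 / of_nat y + 1 / of_nat z"
proof -
  \<comment> \<open>With \<open>q = n div 24\<close>, \<open>n = 24 * q + 13\<close> gives
    \<open>n + 3 = 24 * q + 16 = 8 * (3 * q + 2)\<close>, so \<open>k\<close> is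
    \<open>(n + 3) / 8\<close> written without a division by 8.\<close>
  define k where "k = 3 * (n div 24) + 2"
  have k: "k > 0"
    by (simp add: k_def)
  have "n mod 24 = 13"
    using assms(2) by (simp add: cong_def)
  then have "n + 3 = 8 * k"
    unfolding k_def by presburger
  then have n: "of_nat n + 3 = 8 * (of_nat k :: rat)"
    by (metis of_nat_add of_nat_mult of_nat_numeral)
  \<comment> \<open>Subtracting \<open>1 / (2 * k)\<close>, where \<open>2 * k = (n + 3) / 4\<close>, leaves
    \<open>3 / (2 * n * k)\<close>, and \<open>3 = 2 + 1\<close> is a sum of two divisors of \<open>2 * n * k\<close>.\<close>
  have "(4 :: rat) / of_nat n = (of_nat n + 3) / (2 * of_nat n * of_nat k)"
    unfolding n using k by (simp add: field_simps)
  \<comment> \<open>The numerator splits as \<open>n + 2 + 1\<close>; each part cancels against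
    \<open>2 * n * k\<close> to a unit fraction.\<close>
  also have "\<dots> = 1 / of_nat (2 * k) + 1 / of_nat (n * k) + 1 / of_nat (2 * n * k)"
    using k \<open>n > 0\<close> by (simp add: field_simps)
  \<comment> \<open>The three denominators are the witnesses; only their positivity is left.\<close>
  finally show ?thesis
    using k \<open>n > 0\<close> by (metis nat_0_less_mult_iff zero_less_numeral)
qed

end
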